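(* Let $d,k\ge 1$ and let $\mathbf{P}=(P_1,\dots,P_k)$ be a collection of $d$-dimensional lattice polytopes in $\mathbb{R}^d$. For a positive integer $r$ let $r\mathbf{P}=(rP_1,\dots,rP_k)$ and let $h^*_{r\mathbf{P}}(z)$ be its mixed $h^*$-polynomial. Then, as $r\to\infty$, $$\frac{h^*_{r\mathbf{P}}(z)}{r^d}\ \longrightarrow\ \sum_{J\subseteq[k]}(-1)^{k-|J|}\,\mathrm{vol}(P_J)\,A_d(z),$$ where the convergence is coefficientwise convergence of polynomials in $z$ of degree at most $d$, $\mathrm{vol}$ is $d$-dimensional Lebesgue volume, and $A_d(z)$ is the $d$-th Eulerian polynomial.
   Context: A lattice polytope in $\mathbb{R}^d$ is the convex hull of a nonempty finite subset of $\mathbb{Z}^d$. For $J\subseteq[k]=\{1,\dots,k\}$ put $P_J:=\sum_{j\in J}P_j$ (Minkowski sum), with $P_\emptyset=\{0\}$ (so $\mathrm{vol}(P_\emptyset)=0$). For a lattice polytope $P$, $E_P(n)$ is its Ehrhart polynomial, i.e. the polynomial with $E_P(n)=|nP\cap\mathbb{Z}^d|$ for all integers $n\ge 0$. The mixed Ehrhart polynomial of $\mathbf{P}$ is $$\mathrm{ME}_{\mathbf{P}}(n):=\sum_{J\subseteq[k]}(-1)^{k-|J|}E_{P_J}(n),$$ a polynomial of degree at most $d$. The mixed $h^*$-vector $(h_0^*(\mathbf{P}),\dots,h_d^*(\mathbf{P}))$ is defined by $$\mathrm{ME}_{\mathbf{P}}(n)=\sum_{i=0}^d h_i^*(\mathbf{P})\binom{n+d-i}{d},$$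 and the mixed $h^*$-polynomial is $h^*_{\mathbf{P}}(z):=\sum_{i=0}^d h_i^*(\mathbf{P})z^i$. The $d$-th Eulerian polynomial $A_d(z)$ is defined by $$\sum_{n\ge 0}n^dz^n=\frac{A_d(z)}{(1-z)^{d+1}}.$$ *)

theory Defs
  imports "HOL-Analysis.Analysis" "HOL-Computational_Algebra.Computational_Algebra"
    "HOL-Library.Set_Algebras"
begin

definition integer_points :: "(real ^ 'n::finite) set" where
  "integer_points = {x. \<forall>i. x $ i \<in> \<int>}"

definition lattice_polytope :: "(real ^ 'n::finite) set \<Rightarrow> bool" where
  "lattice_polytope P \<longleftrightarrow>
     (\<exists>V. finite V \<and> V \<noteq> {} \<and> V \<subseteq> integer_points \<and> P = convex hull V)"

definition dilate :: "nat \<Rightarrow> (real ^ 'n::finite) set \<Rightarrow> (real ^ 'n) set" where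
  "dilate n P = (*\<^sub>R) (real n) ` P"

text \<open>
  The sum is the Minkowski sum of sets from \<^theory>\<open>HOL-Library.Set_Algebras\<close>;
  the empty sum is the zero of that monoid, the singleton of the origin.
\<close>
definition mink_sum :: "(nat \<Rightarrow> (real ^ 'n::finite) set) \<Rightarrow> nat set \<Rightarrow> (real ^ 'n) set" where
  "mink_sum P J = (\<Sum>j\<in>J. P j)"

text \<open>
  The definite descriptions below are meaningful because the described objects exist
  uniquely; for \<open>ehrhart_poly\<close> of a lattice polytope this is Ehrhart's theorem.
\<close>
definition ehrhart_poly :: "(real ^ 'n::finite) set \<Rightarrow> real poly" where
  "ehrhart_poly P =
     (THE p. \<forall>n::nat. poly p (real n) = real (card (dilate n P \<inter> integer_points)))"

definition mixed_ehrhart_poly :: "nat \<Rightarrow> (nat \<Rightarrow> (real ^ 'n::finite) set) \<Rightarrow> real poly" where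
  "mixed_ehrhart_poly k P =
     (\<Sum>J\<in>Pow {1..k}. smult ((-1) ^ (k - card J)) (ehrhart_poly (mink_sum P J)))"

text \<open>
  The vector \<open>(h\<^sub>0, \<dots>, h\<^sub>d)\<close>, with \<open>d = CARD('n)\<close>, extended by zero beyond \<open>d\<close>. As \<open>i \<le> d\<close>,
  the subtraction in the binomial coefficient does not truncate.
\<close>
definition mixed_hstar :: "nat \<Rightarrow> (nat \<Rightarrow> (real ^ 'n::finite) set) \<Rightarrow> nat \<Rightarrow> real" where
  "mixed_hstar k P =
     (THE h. (\<forall>i>CARD('n). h i = 0) \<and>
        (\<forall>n::nat. poly (mixed_ehrhart_poly k P) (real n) =
           (\<Sum>i\<le>CARD('n). h i * real ((n + CARD('n) - i) choose CARD('n)))))"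

definition mixed_hstar_poly :: "nat \<Rightarrow> (nat \<Rightarrow> (real ^ 'n::finite) set) \<Rightarrow> real poly" where
  "mixed_hstar_poly k P = (\<Sum>i\<le>CARD('n). monom (mixed_hstar k P i) i)"

definition eulerian_poly :: "nat \<Rightarrow> real poly" where
  "eulerian_poly d =
     (THE A. Abs_fps (\<lambda>n. real n ^ d) = fps_of_poly A / (1 - fps_X) ^ (d + 1))"

end

theory Submission imports Defs begin

text \<open>
  Let \<open>L(n)\<close> count the lattice points of \<open>nP\<close>, where \<open>P\<close> is the convex hull of a set \<open>V\<close> of \<open>m\<close>
  lattice points. Ehrhart's theorem follows without triangulations from the relation
  \<open>\<Sum>\<^bsub>S \<subseteq> V\<^esub> (-1)\<^bsup>|S|\<^esup> [x \<in> \<Sum>S + (N - |S|)P] = 0\<close> for all \<open>x\<close> and \<open>N \<ge> m\<close>: summing it over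
  the lattice points \<open>x\<close> shows that the \<open>m\<close>-th difference of \<open>L\<close> vanishes, so \<open>L\<close> is a
  polynomial on all of \<open>\<nat>\<close>. The relation is an Euler characteristic computation: \<open>x\<close> lies in
  \<open>\<Sum>S + (N - |S|)P\<close> iff the polytope of weights \<open>w \<ge> 0\<close> on \<open>V\<close> with total \<open>N\<close> and
  \<open>\<Sum> w(v) v = x\<close> has a point with \<open>w \<ge> 1\<close> on \<open>S\<close>, and since \<open>N \<ge> m\<close> the conditions
  \<open>w(v) \<ge> 1\<close> cover that polytope, so inclusion-exclusion applies.

  A Riemann sum argument gives \<open>L(n) / n\<^sup>d \<longlongrightarrow> vol P\<close>, which also bounds the degree of \<open>L\<close> by
  \<open>d\<close>. The \<open>h\<^sup>*\<close>-vector of \<open>r\<bold>P\<close> consists of the coefficients of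
  \<open>(1 - z)\<^bsup>d+1\<^esup> \<Sum>\<^sub>n ME(rn) z\<^sup>n\<close>, hence the limit can be taken coefficientwise, and it is the same
  product with \<open>ME(rn)\<close> replaced by the leading coefficient of \<open>ME\<close> times \<open>n\<^sup>d\<close>.
\<close>

unbundle no Formal_Power_Series.fps_syntax

subsection \<open>An Euler relation for compact convex sets\<close>

text \<open>A nonempty compact interval has exactly one right endpoint, so it suffices that the
  coefficients of the intervals ending at any given point cancel.\<close>

lemma interval_euler_relation:
  fixes J :: "'i \<Rightarrow> real set" and a :: "'i \<Rightarrow> real"
  assumes "finite I" "\<And>i. i \<in> I \<Longrightarrow> compact (J i)" "\<And>i. i \<in> I \<Longrightarrow> convex (J i)"
    and rel: "\<And>t. (\<Sum>i\<in>I. a i * of_bool (t \<in> J i)) = 0"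
  shows "(\<Sum>i\<in>I. a i * of_bool (J i \<noteq> {})) = 0"
proof -
  define I' where "I' = {i\<in>I. J i \<noteq> {}}"
  define u where "u i = Sup (J i)" for i
  have "finite I'" using assms(1) by (simp add: I'_def)
  have u: "u i \<in> J i" "\<And>t. t \<in> J i \<Longrightarrow> t \<le> u i" if "i \<in> I'" for i
    using that assms(2)[of i] closed_contains_Sup[of "J i"] cSup_upper[of _ "J i"]
    by (auto simp: I'_def u_def compact_imp_closed compact_imp_bounded bounded_imp_bdd_above)
  have rel': "(\<Sum>i\<in>I'. a i * of_bool (t \<in> J i)) = 0" for t
    using rel[of t] assms(1)
    by (subst sum.mono_neutral_left[of I I']) (auto simp: I'_def)
  \<comment> \<open>The jump of the sum immediately to the right of \<open>s\<close> only sees intervals ending at \<open>s\<close>.\<close>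
  have jump: "(\<Sum>i\<in>I'. a i * of_bool (u i = s)) = 0" for s
  proof -
    have ev: "\<forall>\<^sub>F t in at_right s. of_bool (s \<in> J i) - of_bool (t \<in> J i) = (of_bool (u i = s) :: real)"
      if "i \<in> I'" for i
    proof -
      consider "u i < s" | "u i = s" | "u i > s" "s \<in> J i" | "u i > s" "s \<notin> J i" by linarith
      then show ?thesis
      proof cases
        case 1
        show ?thesis
          using u(2)[OF that] 1 by (intro eventually_at_rightI[of s "s + 1"]) fastforce+
      next
        case 2
        show ?thesis
          using u[OF that] 2 by (intro eventually_at_rightI[of s "s + 1"]) fastforce+
      next
        case 3
        have "t \<in> J i" if "t \<in> {s<..<u i}" for t
          using that 3 u(1)[OF \<open>i \<in> I'\<close>] assms(3)[of i] \<open>i \<in> I'\<close>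
            mem_is_interval_1_I[of "J i" s "u i" t]
          by (auto simp: I'_def is_interval_convex_1)
        then show ?thesis
          using 3 by (intro eventually_at_rightI[of s "u i"]) auto
      next
        case 4
        have "open (- J i)"
          using assms(2)[of i] that by (auto simp: I'_def compact_imp_closed)
        then have "\<forall>\<^sub>F t in at_right s. t \<in> - J i"
          using 4 by (intro topological_tendstoD[OF tendsto_ident_at]) auto
        then show ?thesis
          using 4 by (auto elim!: eventually_mono)
      qed
    qed
    have "\<forall>\<^sub>F t in at_right s. \<forall>i\<in>I'. of_bool (s \<in> J i) - of_bool (t \<in> J i) = (of_bool (u i = s) :: real)"
      using ev \<open>finite I'\<close> by (simp add: eventually_ball_finite_distrib)
    then have "\<exists>t. \<forall>i\<in>I'. of_bool (s \<in> J i) - of_bool (t \<in> J i) = (of_bool (u i = s) :: real)"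
      by (rule eventually_happens'[OF trivial_limit_at_right_real])
    then obtain t where t: "\<forall>i\<in>I'. of_bool (s \<in> J i) - of_bool (t \<in> J i) = (of_bool (u i = s) :: real)"
      by blast
    have "(\<Sum>i\<in>I'. a i * of_bool (u i = s)) =
        (\<Sum>i\<in>I'. a i * of_bool (s \<in> J i)) - (\<Sum>i\<in>I'. a i * of_bool (t \<in> J i))"
      using t by (simp flip: sum_subtractf right_diff_distrib)
    then show ?thesis by (simp only: rel')
  qed
  have "(\<Sum>i\<in>I. a i * of_bool (J i \<noteq> {})) = (\<Sum>i\<in>I'. a i)"
    using assms(1) by (auto intro!: sum.mono_neutral_cong_right simp: I'_def)
  also have "\<dots> = (\<Sum>s\<in>u ` I'. \<Sum>i\<in>{i\<in>I'. u i = s}. a i)"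
    using \<open>finite I'\<close> by (rule sum.image_gen)
  also have "\<dots> = (\<Sum>s\<in>u ` I'. \<Sum>i\<in>I'. a i * of_bool (u i = s))"
    using \<open>finite I'\<close> by (intro sum.cong refl sum.mono_neutral_cong_left) auto
  also have "\<dots> = 0" by (simp only: jump) simp
  finally show ?thesis .
qed

text \<open>
  The linear functional on combinations of indicators of compact convex sets that sends each
  nonempty set to 1 is well defined; the proof integrates out one coordinate at a time.
  The ambient space is a function space because the coordinates will be indexed by the points of
  a finite set \<open>V\<close>, for which there is no type; outside \<open>V\<close> all functions are frozen to \<open>c\<close>.
\<close>
lemma euler_relation:
  fixes K :: "'i \<Rightarrow> ('a \<Rightarrow> real) set" and a :: "'i \<Rightarrow> real"
  assumes "finite V" "finite I"
    and "\<And>i. i \<in> I \<Longrightarrow> compact (K i)"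
    and "\<And>i x y t. i \<in> I \<Longrightarrow> x \<in> K i \<Longrightarrow> y \<in> K i \<Longrightarrow> 0 \<le> t \<Longrightarrow> t \<le> 1 \<Longrightarrow>
           (\<lambda>v. (1 - t) * x v + t * y v) \<in> K i"
    and "\<And>i x v. i \<in> I \<Longrightarrow> x \<in> K i \<Longrightarrow> v \<notin> V \<Longrightarrow> x v = c v"
    and "\<And>x. (\<Sum>i\<in>I. a i * of_bool (x \<in> K i)) = 0"
  shows "(\<Sum>i\<in>I. a i * of_bool (K i \<noteq> {})) = 0"
  using assms(1,3-)
proof (induction V arbitrary: K c rule: finite_induct)
  case empty
  \<comment> \<open>With no free coordinate left, \<open>K i\<close> is either empty or the single
    point \<open>c\<close>.\<close>
  have "K i \<noteq> {} \<longleftrightarrow> c \<in> K i" if "i \<in> I" for i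
    using empty.prems(3)[OF that] by (metis ex_in_conv ext empty_iff)
  then show ?case using empty.prems(4)[of c] by simp
next
  case (insert b V)
  \<comment> \<open>The projection \<open>J i\<close> to coordinate \<open>b\<close> is a compact
    interval, and \<open>t\<close> lies in it iff the slice of \<open>K i\<close> at
    \<open>x b = t\<close> is nonempty. The induction hypothesis for the slices thus yields the
    relation between the intervals.\<close>
  define J where "J i = (\<lambda>x. x b) ` K i" for i
  have "(\<Sum>i\<in>I. a i * of_bool (J i \<noteq> {})) = 0"
  proof (rule interval_euler_relation[OF assms(2)])
    fix i assume i: "i \<in> I"
    show "compact (J i)"
      unfolding J_def using insert.prems(1)[OF i]
      by (intro compact_continuous_image)
         (auto intro: continuous_on_subset[OF continuous_on_product_coordinates])
    show "convex (J i)"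
      unfolding J_def convex_alt using insert.prems(2)[OF i] by fastforce
  next
    fix t
    have "(\<Sum>i\<in>I. a i * of_bool ((K i \<inter> {x. x b = t}) \<noteq> {})) = 0"
    proof (rule insert.IH)
      fix i assume i: "i \<in> I"
      have "closed {x :: 'a \<Rightarrow> real. x b = t}"
        by (intro closed_Collect_eq) auto
      then show "compact (K i \<inter> {x. x b = t})"
        using insert.prems(1)[OF i] by (rule compact_Int_closed[rotated])
      show "(\<lambda>v. (1 - s) * x v + s * y v) \<in> K i \<inter> {x. x b = t}"
        if "x \<in> K i \<inter> {x. x b = t}" "y \<in> K i \<inter> {x. x b = t}" "0 \<le> s" "s \<le> 1" for x y s
        using insert.prems(2)[OF i, of x y s] that by (auto simp: algebra_simps)
      show "x v = (c(b := t)) v" if "x \<in> K i \<inter> {x. x b = t}" "v \<notin> V" for x v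
        using insert.prems(3)[OF i, of x v] that by auto
    next
      fix x
      show "(\<Sum>i\<in>I. a i * of_bool (x \<in> K i \<inter> {x. x b = t})) = 0"
        using insert.prems(4)[of x] by (cases "x b = t") auto
    qed
    moreover have "t \<in> J i \<longleftrightarrow> K i \<inter> {x. x b = t} \<noteq> {}" for i
      by (auto simp: J_def)
    ultimately show "(\<Sum>i\<in>I. a i * of_bool (t \<in> J i)) = 0" by simp
  qed
  then show ?case by (simp add: J_def)
qed

subsection \<open>Finite differences\<close>

definition fdiff :: "(nat \<Rightarrow> real) \<Rightarrow> nat \<Rightarrow> real" where
  "fdiff f n = f (Suc n) - f n"

lemma fdiff_funpow_Suc: "(fdiff ^^ Suc m) f n = (fdiff ^^ m) f (Suc n) - (fdiff ^^ m) f n"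
  by (simp only: funpow.simps o_apply fdiff_def)

text \<open>Apply the induction hypothesis to both \<open>f\<close> and \<open>fdiff f\<close>;
  Pascal's rule merges the two expansions.\<close>

lemma newton_forward_difference: "f n = (\<Sum>j\<le>n. real (n choose j) * (fdiff ^^ j) f 0)"
proof (induction n arbitrary: f)
  case (Suc n)
  let ?D = "\<lambda>j. (fdiff ^^ j) f 0"
  have "f (Suc n) = f n + fdiff f n" by (simp add: fdiff_def)
  also have "\<dots> = (\<Sum>j\<le>n. real (n choose j) * ?D j) + (\<Sum>j\<le>n. real (n choose j) * ?D (Suc j))"
    using Suc.IH[of f] Suc.IH[of "fdiff f"] by (simp add: funpow_swap1)
  \<comment> \<open>The term added at \<open>j = Suc n\<close> carries the coefficient
    \<open>n choose Suc n\<close>, which is 0.\<close>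
  also have "(\<Sum>j\<le>n. real (n choose j) * ?D j) = (\<Sum>j\<le>Suc n. real (n choose j) * ?D j)"
    by simp
  also have "\<dots> = ?D 0 + (\<Sum>j\<le>n. real (n choose Suc j) * ?D (Suc j))"
    by (subst sum.atMost_Suc_shift) simp
  finally have "f (Suc n) = ?D 0 + (\<Sum>j\<le>n. real (Suc n choose Suc j) * ?D (Suc j))"
    by (simp add: sum.distrib ring_distribs)
  also have "\<dots> = (\<Sum>j\<le>Suc n. real (Suc n choose j) * ?D j)"
    by (subst sum.atMost_Suc_shift) simp
  finally show ?case .
qed simp

text \<open>Newton's expansion stops before the \<open>m\<close>-th term, and each
  \<open>n choose j\<close> is a polynomial in \<open>n\<close>.\<close>

lemma fdiff_zero_imp_poly:
  assumes "(fdiff ^^ m) f = (\<lambda>_. 0)"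
  shows "\<exists>p. \<forall>n. poly p (real n) = f n"
proof -
  have zero: "(fdiff ^^ j) f = (\<lambda>_. 0)" if "j \<ge> m" for j
    using that by (induction rule: dec_induct) (simp_all only: assms fdiff_funpow_Suc fun_eq_iff diff_self simp_thms)
  define p where
    "p = (\<Sum>j<m. smult ((fdiff ^^ j) f 0 / fact j) (\<Prod>i = 0..<j. [:- real i, 1:]))"
  have "poly p (real n) = f n" for n
  proof -
    have "f n = (\<Sum>j\<le>n. real (n choose j) * (fdiff ^^ j) f 0)"
      by (rule newton_forward_difference)
    \<comment> \<open>Terms with \<open>j > n\<close> vanish through the binomial, terms with
      \<open>j \<ge> m\<close> through the difference.\<close>
    also have "\<dots> = (\<Sum>j<m. real (n choose j) * (fdiff ^^ j) f 0)"
      by (rule sum.mono_neutral_cong) (auto simp: zero binomial_eq_0)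
    also have "\<dots> = poly p (real n)"
      by (auto simp: p_def poly_sum poly_prod binomial_gbinomial gbinomial_prod_rev intro!: sum.cong)
    finally show ?thesis ..
  qed
  then show ?thesis by blast
qed

lemma sum_Pow_insert:
  fixes g :: "'a set \<Rightarrow> 'b::comm_monoid_add"
  assumes "finite A" "x \<notin> A"
  shows "(\<Sum>S\<in>Pow (insert x A). g S) = (\<Sum>S\<in>Pow A. g S) + (\<Sum>S\<in>Pow A. g (insert x S))"
proof -
  have "inj_on (insert x) (Pow A)"
    using assms(2) by (auto simp: inj_on_def)
  moreover have "(\<Sum>S\<in>Pow (insert x A). g S) = (\<Sum>S\<in>Pow A. g S) + (\<Sum>S\<in>insert x ` Pow A. g S)"
    unfolding Pow_insert using assms by (intro sum.union_disjoint) auto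
  ultimately show ?thesis by (simp add: sum.reindex)
qed

text \<open>This is the binomial expansion of an iterated difference, indexed by subsets instead of
  their sizes so that it matches the Euler relation over \<open>Pow V\<close>.\<close>

lemma fdiff_funpow_card:
  assumes "finite W"
  shows "(fdiff ^^ card W) f n = (\<Sum>S\<in>Pow W. (-1) ^ card S * f (n + card W - card S))"
  using assms
proof (induction W arbitrary: n rule: finite_induct)
  case (insert w W)
  have fin: "finite S" "w \<notin> S" "card S \<le> card W" if "S \<in> Pow W" for S
    using that insert.hyps by (auto intro: finite_subset card_mono)
  show ?case
    using insert.hyps fin
    by (simp add: sum_Pow_insert fdiff_funpow_Suc insert.IH sum_negf Suc_diff_le del: funpow.simps)
qed simp

text \<open>Expand the product of the factors \<open>-1 + 1\<close> over \<open>A\<close>.\<close>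

lemma sum_Pow_alternating:
  assumes "finite A" "A \<noteq> {}"
  shows "(\<Sum>S\<in>Pow A. (-1) ^ card S) = (0::real)"
  using prod_add[OF assms(1), of "\<lambda>_. -1::real" "\<lambda>_. 1"] assms by (simp add: power_0_left)

subsection \<open>Ehrhart's theorem\<close>

lemma finite_bounded_integer_points:
  fixes B :: "(real ^ 'n::finite) set"
  assumes "bounded B"
  shows "finite (B \<inter> integer_points)"
proof -
  obtain a b where ab: "B \<subseteq> cbox a b"
    using assms bounded_subset_cbox_symmetric by blast
  let ?F = "PiE (UNIV :: 'n set) (\<lambda>i. {\<lfloor>a $ i\<rfloor>..\<lfloor>b $ i\<rfloor>})"
  have "B \<inter> integer_points \<subseteq> (\<lambda>f. \<chi> i. real_of_int (f i)) ` ?F"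
  proof
    fix x assume x: "x \<in> B \<inter> integer_points"
    have "x = (\<chi> i. real_of_int \<lfloor>x $ i\<rfloor>)"
      using x by (auto simp: vec_eq_iff integer_points_def)
    moreover have "(\<lambda>i. \<lfloor>x $ i\<rfloor>) \<in> ?F"
      using x ab by (auto simp: subset_iff mem_box_cart intro!: floor_mono)
    ultimately show "x \<in> (\<lambda>f. \<chi> i. real_of_int (f i)) ` ?F" by (rule image_eqI)
  qed
  then show ?thesis
    by (rule finite_subset) (intro finite_imageI finite_PiE, auto)
qed

lemma integer_points_add: "x \<in> integer_points \<Longrightarrow> y \<in> integer_points \<Longrightarrow> x + y \<in> integer_points"
  by (auto simp: integer_points_def)

lemma integer_points_diff: "x \<in> integer_points \<Longrightarrow> y \<in> integer_points \<Longrightarrow> x - y \<in> integer_points"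
  by (auto simp: integer_points_def)

lemma integer_points_sum: "V \<subseteq> integer_points \<Longrightarrow> \<Sum>V \<in> integer_points"
  by (auto simp: integer_points_def intro!: Ints_sum)

section \<open>Polytopes of weights and their Euler relation\<close>

definition weights :: "'a::real_vector set \<Rightarrow> nat \<Rightarrow> 'a set \<Rightarrow> 'a \<Rightarrow> ('a \<Rightarrow> real) set" where
  "weights V N S x =
     {w. (\<forall>v. v \<notin> V \<longrightarrow> w v = 0) \<and> (\<forall>v\<in>V. of_bool (v \<in> S) \<le> w v) \<and>
         (\<Sum>v\<in>V. w v) = real N \<and> (\<Sum>v\<in>V. w v *\<^sub>R v) = x}"

lemma dilate_convex_hull:
  assumes "finite V" "V \<noteq> {}"
  shows "y \<in> dilate n (convex hull V) \<longleftrightarrow>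
    (\<exists>w. (\<forall>v\<in>V. 0 \<le> w v) \<and> (\<Sum>v\<in>V. w v) = real n \<and> (\<Sum>v\<in>V. w v *\<^sub>R v) = y)"
proof
  assume "y \<in> dilate n (convex hull V)"
  then obtain u where "\<forall>v\<in>V. 0 \<le> u v" "sum u V = 1" "y = real n *\<^sub>R (\<Sum>v\<in>V. u v *\<^sub>R v)"
    by (auto simp: dilate_def convex_hull_finite[OF assms(1)])
  then show "\<exists>w. (\<forall>v\<in>V. 0 \<le> w v) \<and> (\<Sum>v\<in>V. w v) = real n \<and> (\<Sum>v\<in>V. w v *\<^sub>R v) = y"
    by (intro exI[of _ "\<lambda>v. real n * u v"]) (simp add: scaleR_sum_right flip: sum_distrib_left)
next
  assume "\<exists>w. (\<forall>v\<in>V. 0 \<le> w v) \<and> (\<Sum>v\<in>V. w v) = real n \<and> (\<Sum>v\<in>V. w v *\<^sub>R v) = y"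
  then obtain w where w: "\<forall>v\<in>V. 0 \<le> w v" "(\<Sum>v\<in>V. w v) = real n" "(\<Sum>v\<in>V. w v *\<^sub>R v) = y"
    by blast
  show "y \<in> dilate n (convex hull V)"
  proof (cases "n = 0")
    \<comment> \<open>Rescaling by \<open>1 / n\<close> is impossible here; instead, nonnegative
      weights of total 0 all vanish.\<close>
    case True
    then have "\<forall>v\<in>V. w v = 0"
      using w assms by (simp add: sum_nonneg_eq_0_iff)
    then have "y = 0" using w(3) by simp
    then show ?thesis using True assms(2) by (auto simp: dilate_def image_iff)
  next
    case False
    have "(\<Sum>v\<in>V. (w v / real n) *\<^sub>R v) \<in> convex hull V"
      using w False unfolding convex_hull_finite[OF assms(1)]
      by (auto intro!: exI[of _ "\<lambda>v. w v / real n"] simp flip: sum_divide_distrib)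
    moreover have "real n *\<^sub>R (\<Sum>v\<in>V. (w v / real n) *\<^sub>R v) = y"
      using False w(3) by (simp add: scaleR_sum_right)
    ultimately show ?thesis by (auto simp: dilate_def)
  qed
qed

text \<open>Subtracting the indicator of \<open>S\<close> from a weight turns the bound 1 on
  \<open>S\<close> into 0, lowers the total by \<open>card S\<close> and moves the represented point
  by \<open>\<Sum>S\<close>.\<close>

lemma weights_nonempty_iff:
  assumes "finite V" "V \<noteq> {}" "S \<subseteq> V" "card S \<le> N"
  shows "weights V N S x \<noteq> {} \<longleftrightarrow> x - \<Sum>S \<in> dilate (N - card S) (convex hull V)"
proof -
  have sum_S: "(\<Sum>v\<in>V. of_bool (v \<in> S)) = real (card S)"
    "(\<Sum>v\<in>V. of_bool (v \<in> S) *\<^sub>R v) = \<Sum>S"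
    using assms by (simp_all add: Int_absorb1 of_bool_def if_distrib if_distribR sum.If_cases
      cong: if_cong)
  show ?thesis unfolding dilate_convex_hull[OF assms(1,2)]
  proof
    assume "weights V N S x \<noteq> {}"
    then obtain w where w: "\<forall>v\<in>V. of_bool (v \<in> S) \<le> w v" "(\<Sum>v\<in>V. w v) = real N"
      "(\<Sum>v\<in>V. w v *\<^sub>R v) = x"
      by (auto simp: weights_def)
    show "\<exists>w. (\<forall>v\<in>V. 0 \<le> w v) \<and> (\<Sum>v\<in>V. w v) = real (N - card S) \<and> (\<Sum>v\<in>V. w v *\<^sub>R v) = x - \<Sum>S"
      using w sum_S assms(4)
      by (intro exI[of _ "\<lambda>v. w v - of_bool (v \<in> S)"])
         (auto simp only: sum_subtractf scaleR_diff_left of_nat_diff diff_ge_0_iff_ge)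
  next
    assume "\<exists>w. (\<forall>v\<in>V. 0 \<le> w v) \<and> (\<Sum>v\<in>V. w v) = real (N - card S) \<and> (\<Sum>v\<in>V. w v *\<^sub>R v) = x - \<Sum>S"
    then obtain w where w: "\<forall>v\<in>V. 0 \<le> w v" "(\<Sum>v\<in>V. w v) = real (N - card S)"
      "(\<Sum>v\<in>V. w v *\<^sub>R v) = x - \<Sum>S"
      by blast
    define w' where "w' v = (if v \<in> V then w v + of_bool (v \<in> S) else 0)" for v
    have "(\<Sum>v\<in>V. w' v) = (\<Sum>v\<in>V. w v) + (\<Sum>v\<in>V. of_bool (v \<in> S))"
      "(\<Sum>v\<in>V. w' v *\<^sub>R v) = (\<Sum>v\<in>V. w v *\<^sub>R v) + (\<Sum>v\<in>V. of_bool (v \<in> S) *\<^sub>R v)"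
      by (simp_all add: w'_def scaleR_add_left flip: sum.distrib)
    then have "w' \<in> weights V N S x"
      using w assms(4) unfolding sum_S by (auto simp: weights_def w'_def of_nat_diff)
    then show "weights V N S x \<noteq> {}" by blast
  qed
qed

text \<open>Nonnegative weights of total \<open>N\<close> lie in \<open>[0, N]\<close> on
  \<open>V\<close> and are 0 elsewhere, so they form a closed subset of a product of compact sets,
  which is compact by Tychonoff's theorem.\<close>

lemma compact_weights:
  fixes V :: "'a::real_normed_vector set"
  assumes "finite V"
  shows "compact (weights V N S x)"
proof -
  define B where "B v = (if v \<in> V then {0..real N} else {0})" for v
  have "compact (PiE UNIV B)"
    unfolding compactin_euclidean_iff[symmetric] euclidean_product_topology[symmetric]
    by (subst compactin_PiE) (auto simp: B_def)
  moreover have "closed (weights V N S x)"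
  proof -
    have cont: "continuous_on UNIV (\<lambda>w :: 'a \<Rightarrow> real. w v)" for v by simp
    have "weights V N S x = (\<Inter>v\<in>-V. {w. w v = 0}) \<inter> (\<Inter>v\<in>V. {w. of_bool (v \<in> S) \<le> w v}) \<inter>
        {w. (\<Sum>v\<in>V. w v) = real N} \<inter> {w. (\<Sum>v\<in>V. w v *\<^sub>R v) = x}"
      unfolding weights_def set_eq_iff Int_iff INT_iff mem_Collect_eq by blast
    moreover have "closed \<dots>"
      by (intro closed_Int closed_INT ballI closed_Collect_eq closed_Collect_le
           continuous_intros cont)
    ultimately show ?thesis by simp
  qed
  moreover have "weights V N S x \<subseteq> PiE UNIV B"
  proof
    fix w assume w: "w \<in> weights V N S x"
    have nonneg: "0 \<le> w v" if "v \<in> V" for v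
      using w that order_trans[of 0 "of_bool (v \<in> S)" "w v"] by (auto simp: weights_def)
    have "w v \<le> real N" if "v \<in> V" for v
      using w member_le_sum[of v V w] that assms nonneg by (auto simp: weights_def)
    then show "w \<in> PiE UNIV B"
      using w nonneg by (auto simp: B_def weights_def)
  qed
  ultimately show ?thesis
    by (metis compact_Int_closed inf.absorb_iff2)
qed

lemma convex_weights:
  assumes "w \<in> weights V N S x" "w' \<in> weights V N S x" "0 \<le> t" "t \<le> 1"
  shows "(\<lambda>v. (1 - t) * w v + t * w' v) \<in> weights V N S x"
proof -
  have "c \<le> (1 - t) * a + t * b" if "c \<le> a" "c \<le> b" for a b c :: real
    using that assms(3,4) convex_bound_le[of "- a" "- c" "- b" "1 - t" t] by simp
  moreover have "(\<Sum>v\<in>V. ((1 - t) * w v + t * w' v) *\<^sub>R v) =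
      (1 - t) *\<^sub>R (\<Sum>v\<in>V. w v *\<^sub>R v) + t *\<^sub>R (\<Sum>v\<in>V. w' v *\<^sub>R v)"
    by (simp add: scaleR_add_left scaleR_sum_right sum.distrib)
  moreover have "(\<Sum>v\<in>V. (1 - t) * w v + t * w' v) = (1 - t) * (\<Sum>v\<in>V. w v) + t * (\<Sum>v\<in>V. w' v)"
    by (simp add: sum.distrib sum_distrib_left)
  moreover have "(1 - t) *\<^sub>R x + t *\<^sub>R x = x" "(1 - t) * real N + t * real N = real N"
    by (simp_all add: algebra_simps)
  ultimately show ?thesis
    using assms(1,2) by (auto simp: weights_def)
qed

text \<open>A fixed \<open>w\<close> satisfies the constraints for exactly those \<open>S\<close> on
  which its values are at least 1. These are the subsets of a nonempty set, so their signs cancel,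
  and \<open>euler_relation\<close> passes from membership to nonemptiness.\<close>

lemma weights_euler_relation:
  fixes V :: "'a::real_normed_vector set"
  assumes "finite V" "V \<noteq> {}" "card V \<le> N"
  shows "(\<Sum>S\<in>Pow V. (-1) ^ card S * of_bool (weights V N S x \<noteq> {})) = (0::real)"
proof (rule euler_relation[where V = V and c = "\<lambda>_. 0"])
  fix w :: "'a \<Rightarrow> real"
  show "(\<Sum>S\<in>Pow V. (-1) ^ card S * of_bool (w \<in> weights V N S x)) = (0::real)"
  proof (cases "w \<in> weights V N {} x")
    case False
    have "w \<notin> weights V N S x" for S
      using False order_trans[of 0 "of_bool (_ \<in> S) :: real"] by (force simp: weights_def)
    then show ?thesis by simp
  next
    case True
    define T where "T = {v\<in>V. 1 \<le> w v}"
    \<comment> \<open>If all weights were below 1, their total would be below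
      \<open>card V \<le> N\<close>.\<close>
    have "T \<noteq> {}"
    proof
      assume "T = {}"
      then have "(\<Sum>v\<in>V. w v) < (\<Sum>v\<in>V. 1)"
        using assms(1,2) by (intro sum_strict_mono) (auto simp: T_def not_le)
      then show False using True assms(3) by (simp add: weights_def)
    qed
    have "w \<in> weights V N S x \<longleftrightarrow> S \<in> Pow T" if "S \<in> Pow V" for S
      using True that by (fastforce simp: weights_def T_def of_bool_def)
    then have "(\<Sum>S\<in>Pow V. (-1) ^ card S * of_bool (w \<in> weights V N S x)) =
        (\<Sum>S\<in>Pow T. (-1) ^ card S :: real)"
      using assms(1) by (intro sum.mono_neutral_cong_right) (auto simp: T_def)
    then show ?thesis
      using sum_Pow_alternating[of T] \<open>T \<noteq> {}\<close> assms(1) by (simp add: T_def)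
  qed
qed (use assms(1) in \<open>auto simp: compact_weights intro: convex_weights, auto simp: weights_def\<close>)

section \<open>Polynomiality of the lattice point count\<close>

definition lattice_count :: "(real ^ 'n::finite) set \<Rightarrow> nat \<Rightarrow> real" where
  "lattice_count P n = real (card (dilate n P \<inter> integer_points))"

lemma bounded_dilate: "bounded P \<Longrightarrow> bounded (dilate n P)"
  unfolding dilate_def by (rule bounded_scaling)

lemma fdiff_lattice_count:
  fixes V :: "(real ^ 'n::finite) set"
  assumes V: "finite V" "V \<noteq> {}" "V \<subseteq> integer_points"
  shows "(fdiff ^^ card V) (lattice_count (convex hull V)) = (\<lambda>_. 0)"
proof
  fix n
  define N where "N = n + card V"
  define D where "D m = dilate m (convex hull V)" for m
  \<comment> \<open>\<open>X\<close> is a finite set holding the lattice points of all translates in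
    the relation, so that the sums over \<open>x\<close> and \<open>S\<close> may be
    swapped.\<close>
  define X where "X = integer_points \<inter> (\<Union>S\<in>Pow V. (+) (\<Sum>S) ` D (N - card S))"
  have bounded_D: "bounded (D m)" for m
    unfolding D_def using V(1)
    by (intro bounded_dilate bounded_convex_hull finite_imp_bounded)
  have "finite X"
    unfolding X_def Int_UN_distrib using V(1) bounded_D
    by (auto simp: Int_commute[of integer_points] intro!: finite_bounded_integer_points bounded_translation)
  have count: "lattice_count (convex hull V) (N - card S) =
      (\<Sum>x\<in>X. of_bool (weights V N S x \<noteq> {}))" if S: "S \<in> Pow V" for S
  proof -
    have card_S: "card S \<le> N"
      using S V(1) card_mono[of V S] by (simp add: N_def)
    have int: "\<Sum>S \<in> integer_points"
      using S V(3) by (intro integer_points_sum) auto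
    \<comment> \<open>Translation by the lattice vector \<open>\<Sum>S\<close> preserves the
      lattice.\<close>
    have "bij_betw ((+) (\<Sum>S)) (D (N - card S) \<inter> integer_points)
        {x\<in>X. x - \<Sum>S \<in> D (N - card S)}"
    proof (rule bij_betw_byWitness[where f' = "\<lambda>x. x - \<Sum>S"])
      show "(+) (\<Sum>S) ` (D (N - card S) \<inter> integer_points) \<subseteq> {x\<in>X. x - \<Sum>S \<in> D (N - card S)}"
        using S integer_points_add[OF int] by (auto simp: X_def)
      show "(\<lambda>x. x - \<Sum>S) ` {x\<in>X. x - \<Sum>S \<in> D (N - card S)} \<subseteq> D (N - card S) \<inter> integer_points"
        using integer_points_diff[OF _ int] by (auto simp: X_def)
    qed auto
    then have "lattice_count (convex hull V) (N - card S) =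
        real (card {x\<in>X. x - \<Sum>S \<in> D (N - card S)})"
      unfolding lattice_count_def D_def by (simp only: bij_betw_same_card)
    also have "\<dots> = (\<Sum>x\<in>X. of_bool (x - \<Sum>S \<in> D (N - card S)))"
      using \<open>finite X\<close> by (simp add: Int_def)
    finally show ?thesis
      using weights_nonempty_iff[OF V(1,2) _ card_S] S by (simp add: D_def)
  qed
  have "(fdiff ^^ card V) (lattice_count (convex hull V)) n =
      (\<Sum>S\<in>Pow V. (-1) ^ card S * (\<Sum>x\<in>X. of_bool (weights V N S x \<noteq> {})))"
    unfolding fdiff_funpow_card[OF V(1)] N_def[symmetric] by (intro sum.cong refl) (simp add: count)
  also have "\<dots> = (\<Sum>x\<in>X. \<Sum>S\<in>Pow V. (-1) ^ card S * of_bool (weights V N S x \<noteq> {}))"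
    unfolding sum_distrib_left by (rule sum.swap)
  also have "\<dots> = 0"
    using weights_euler_relation[OF V(1,2)] by (simp add: N_def)
  finally show "(fdiff ^^ card V) (lattice_count (convex hull V)) n = 0" .
qed

lemma poly_eqI_nat:
  fixes p q :: "real poly"
  assumes "\<And>n::nat. poly p (real n) = poly q (real n)"
  shows "p = q"
proof (rule poly_eqI_degree[of "real ` {..max (degree p) (degree q)}"])
  show "degree p < card (real ` {..max (degree p) (degree q)})"
    "degree q < card (real ` {..max (degree p) (degree q)})"
    by (simp_all add: card_image)
qed (use assms in auto)

text \<open>This discharges the definite description: existence comes from the vanishing difference,
  uniqueness from agreement at all naturals.\<close>

lemma ehrhart_poly_eq:
  assumes "lattice_polytope P"
  shows "poly (ehrhart_poly P) (real n) = lattice_count P n"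
proof -
  obtain V where V: "finite V" "V \<noteq> {}" "V \<subseteq> integer_points" "P = convex hull V"
    using assms by (auto simp: lattice_polytope_def)
  obtain p where p: "\<forall>n. poly p (real n) = lattice_count P n"
    using fdiff_zero_imp_poly[OF fdiff_lattice_count[OF V(1-3)]] V(4) by blast
  have "\<forall>n. poly (ehrhart_poly P) (real n) = real (card (dilate n P \<inter> integer_points))"
    unfolding ehrhart_poly_def
  proof (rule theI)
    show "\<forall>n. poly p (real n) = real (card (dilate n P \<inter> integer_points))"
      using p by (simp add: lattice_count_def)
    then show "q = p" if "\<forall>n. poly q (real n) = real (card (dilate n P \<inter> integer_points))" for q
      using that by (intro poly_eqI_nat) simp
  qed
  then show ?thesis by (simp add: lattice_count_def)
qed

subsection \<open>Volume asymptotics\<close>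

text \<open>After division by \<open>n\<close> this is the lower corner of the half-open cube of
  side \<open>1 / n\<close> in the scaled grid that contains \<open>y\<close>.\<close>

definition grid_point :: "nat \<Rightarrow> real ^ 'n::finite \<Rightarrow> real ^ 'n" where
  "grid_point n y = (\<chi> i. of_int \<lfloor>real n * y $ i\<rfloor>)"

lemma grid_point_close:
  fixes y :: "real ^ 'n::finite"
  assumes "n > 0"
  shows "norm (grid_point n y /\<^sub>R real n - y) \<le> real CARD('n) / real n"
proof -
  have "norm (grid_point n y /\<^sub>R real n - y) \<le> (\<Sum>i\<in>UNIV. \<bar>(grid_point n y /\<^sub>R real n - y) $ i\<bar>)"
    by (rule norm_le_l1_cart)
  also have "\<dots> \<le> (\<Sum>i\<in>(UNIV :: 'n set). 1 / real n)"
  proof (rule sum_mono)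
    fix i
    have "(grid_point n y /\<^sub>R real n - y) $ i = (of_int \<lfloor>real n * y $ i\<rfloor> - real n * y $ i) / real n"
      using assms by (simp add: grid_point_def field_simps)
    moreover have "\<bar>of_int \<lfloor>real n * y $ i\<rfloor> - real n * y $ i\<bar> \<le> 1" by linarith
    ultimately show "\<bar>(grid_point n y /\<^sub>R real n - y) $ i\<bar> \<le> 1 / real n"
      by (simp add: abs_divide divide_right_mono)
  qed
  finally show ?thesis by simp
qed

lemma grid_point_tendsto:
  fixes y :: "real ^ 'n::finite"
  shows "(\<lambda>n. grid_point n y /\<^sub>R real n) \<longlonglongrightarrow> y"
proof -
  have "(\<lambda>n. grid_point n y /\<^sub>R real n - y) \<longlonglongrightarrow> 0"
  proof (rule Lim_null_comparison)
    show "\<forall>\<^sub>F n in sequentially. norm (grid_point n y /\<^sub>R real n - y) \<le> real CARD('n) / real n"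
      using eventually_gt_at_top[of 0] by eventually_elim (rule grid_point_close)
  qed (rule lim_const_over_n)
  then show ?thesis by (simp add: LIM_zero_iff)
qed

text \<open>The set lies between the open and the closed box with the same corners, whose volumes
  agree.\<close>

lemma measure_half_open_box:
  fixes a :: "real ^ 'n::finite"
  assumes "c \<ge> 0"
  shows "{y. \<forall>i. a $ i \<le> y $ i \<and> y $ i < a $ i + c} \<in> sets lborel" (is "?H \<in> _")
    and "emeasure lborel {y. \<forall>i. a $ i \<le> y $ i \<and> y $ i < a $ i + c} = ennreal (c ^ CARD('n))"
proof -
  let ?b = "\<chi> i. a $ i + c"
  have "?H = (\<Inter>i. {y. a $ i \<le> y $ i} \<inter> {y. y $ i < a $ i + c})" by auto
  moreover have "\<dots> \<in> sets borel"
    by (intro sets.countable_INT'' sets.Int borel_closed borel_open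
         closed_Collect_le open_Collect_less continuous_intros) auto
  ultimately show H: "?H \<in> sets lborel" by simp
  have le: "a \<bullet> e \<le> ?b \<bullet> e" if "e \<in> Basis" for e
    using that assms by (auto simp: Basis_vec_def inner_axis)
  have prod: "(\<Prod>e\<in>Basis. (?b - a) \<bullet> e) = c ^ CARD('n)"
  proof -
    have "(\<Prod>e\<in>Basis. (?b - a) \<bullet> e) = (\<Prod>e\<in>(Basis :: (real ^ 'n) set). c)"
      by (intro prod.cong) (auto simp: Basis_vec_def inner_axis)
    then show ?thesis by simp
  qed
  have "emeasure lborel ?H \<le> emeasure lborel (cbox a ?b)"
    by (intro emeasure_mono) (auto simp: mem_box_cart less_le_not_le)
  moreover have "emeasure lborel (box a ?b) \<le> emeasure lborel ?H"
    using H by (intro emeasure_mono) (auto simp: mem_box_cart intro: less_imp_le)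
  ultimately show "emeasure lborel ?H = ennreal (c ^ CARD('n))"
    using emeasure_lborel_box[of a ?b] emeasure_lborel_cbox[of a ?b] le prod
    by (simp add: order_antisym)
qed

lemma grid_cell_eq:
  fixes z :: "real ^ 'n::finite"
  assumes "n > 0" "z \<in> integer_points"
  shows "{y. grid_point n y = z} = {y. \<forall>i. (z /\<^sub>R real n) $ i \<le> y $ i \<and> y $ i < (z /\<^sub>R real n) $ i + 1 / real n}"
proof -
  have "(of_int \<lfloor>real n * t\<rfloor> = s) \<longleftrightarrow> s / real n \<le> t \<and> t < s / real n + 1 / real n"
    if "s \<in> \<int>" for s t :: real
  proof -
    obtain m where "s = of_int m" using \<open>s \<in> \<int>\<close> by (auto elim: Ints_cases)
    then show ?thesis using assms(1) by (simp add: floor_eq_iff field_simps)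
  qed
  then show ?thesis
    using assms(2) by (auto simp: vec_eq_iff grid_point_def integer_points_def divide_inverse_commute)
qed

text \<open>\<open>A\<close> is a disjoint union of cubes of side \<open>1 / n\<close>, one for each
  lattice point of \<open>dilate n P\<close>. The count is thus the exact volume of an approximation
  to \<open>P\<close>.\<close>

lemma measure_grid_approximation:
  fixes P :: "(real ^ 'n::finite) set"
  assumes "bounded P" "n > 0"
  defines "A \<equiv> {y. grid_point n y /\<^sub>R real n \<in> P}"
  shows "A \<in> sets lborel" and "measure lborel A = lattice_count P n / real n ^ CARD('n)"
proof -
  define Z where "Z = dilate n P \<inter> integer_points"
  define C where "C z = {y. grid_point n y = z}" for z :: "real ^ 'n"
  have "finite Z"
    unfolding Z_def using assms(1) by (intro finite_bounded_integer_points bounded_dilate)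
  have "grid_point n y /\<^sub>R real n \<in> P \<longleftrightarrow> grid_point n y \<in> dilate n P" for y
    using assms(2) by (force simp: dilate_def image_iff)
  moreover have "grid_point n y \<in> integer_points" for y :: "real ^ 'n"
    by (simp add: grid_point_def integer_points_def)
  ultimately have A_eq: "A = (\<Union>z\<in>Z. C z)"
    by (auto simp: A_def Z_def C_def)
  have C: "C z \<in> sets lborel" "emeasure lborel (C z) = ennreal ((1 / real n) ^ CARD('n))"
    if "z \<in> Z" for z
    using that measure_half_open_box[of "1 / real n" "z /\<^sub>R real n"] grid_cell_eq[OF assms(2), of z]
    by (simp_all add: C_def Z_def)
  show "A \<in> sets lborel"
    unfolding A_eq using \<open>finite Z\<close> C(1) by (intro sets.finite_UN) auto
  have "measure lborel A = (\<Sum>z\<in>Z. measure lborel (C z))"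
    unfolding A_eq
  proof (rule measure_finite_Union)
    show "C ` Z \<subseteq> sets lborel" using C(1) by blast
    show "disjoint_family_on C Z" by (auto simp: disjoint_family_on_def C_def)
    show "emeasure lborel (C z) \<noteq> \<infinity>" if "z \<in> Z" for z using C(2)[OF that] by simp
  qed fact
  also have "\<dots> = (\<Sum>z\<in>Z. (1 / real n) ^ CARD('n))"
    using C(2) by (intro sum.cong refl) (simp add: measure_def)
  also have "\<dots> = lattice_count P n / real n ^ CARD('n)"
    by (simp add: lattice_count_def Z_def power_divide)
  finally show "measure lborel A = lattice_count P n / real n ^ CARD('n)" .
qed

text \<open>Dominated convergence: the indicators of the grid approximations converge to that of
  \<open>P\<close> off the frontier, which is a null set because \<open>P\<close> is convex.\<close>

lemma lattice_count_asymptotics: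
  fixes P :: "(real ^ 'n::finite) set"
  assumes "compact P" "convex P"
  shows "(\<lambda>n. lattice_count P n / real n ^ CARD('n)) \<longlonglongrightarrow> measure lebesgue P"
proof -
  define A where "A n = {y. grid_point n y /\<^sub>R real n \<in> P}" for n
  have bdd: "bounded P" using assms(1) by (rule compact_imp_bounded)
  obtain R where R: "\<And>x. x \<in> P \<Longrightarrow> norm x \<le> R"
    using bdd by (auto simp: bounded_iff)
  \<comment> \<open>The radius bounds \<open>P\<close> and adds the largest rounding error, which is
    at most \<open>CARD('n)\<close> for positive scale; hence the index
    \<open>Suc n\<close>.\<close>
  let ?B = "cball (0 :: real ^ 'n) (R + real CARD('n))"
  have A_sub: "A (Suc n) \<subseteq> ?B" for n
  proof
    fix y assume "y \<in> A (Suc n)"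
    then have "norm (grid_point (Suc n) y /\<^sub>R real (Suc n)) \<le> R"
      unfolding A_def using R by blast
    moreover have "norm (grid_point (Suc n) y /\<^sub>R real (Suc n) - y) \<le> real CARD('n)"
      using grid_point_close[of "Suc n" y] by (rule order_trans) (auto simp: field_simps)
    ultimately show "y \<in> ?B"
      using norm_triangle_ineq3[of y "grid_point (Suc n) y /\<^sub>R real (Suc n)"]
      by (simp add: norm_minus_commute)
  qed
  have A: "A (Suc n) \<in> sets lborel"
    "measure lborel (A (Suc n)) = lattice_count P (Suc n) / real (Suc n) ^ CARD('n)" for n
    unfolding A_def using measure_grid_approximation[OF bdd, of "Suc n"] by simp_all
  have "(\<lambda>n. \<integral>y. indicator (A (Suc n)) y \<partial>lebesgue) \<longlonglongrightarrow> (\<integral>y. indicator P y \<partial>lebesgue :: real)"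
  proof (rule integral_dominated_convergence)
    show "indicator P \<in> borel_measurable lebesgue"
      using assms(1) by (intro borel_measurable_indicator fmeasurableD lmeasurable_compact)
    show "indicator (A (Suc n)) \<in> borel_measurable lebesgue" for n
      using A(1)[of n] by (intro borel_measurable_indicator sets_completionI_sets)
    show "integrable lebesgue (indicator ?B :: _ \<Rightarrow> real)"
      using lmeasurable_cball[of 0 "R + real CARD('n)"]
      unfolding fmeasurable_def mem_Collect_eq by (metis integrable_real_indicator)
    show "AE y in lebesgue. norm (indicator (A (Suc n)) y :: real) \<le> indicator ?B y" for n
      using A_sub[of n] by (intro AE_I2) (simp add: indicator_def subset_iff)
    have "AE y in lebesgue. y \<notin> frontier P"
      using negligible_convex_frontier[OF assms(2)]
      by (intro AE_not_in) (simp add: negligible_iff_null_sets)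
    then show "AE y in lebesgue. (\<lambda>n. indicator (A (Suc n)) y) \<longlonglongrightarrow> (indicator P y :: real)"
    proof eventually_elim
      case (elim y)
      have lim: "(\<lambda>n. grid_point (Suc n) y /\<^sub>R real (Suc n)) \<longlonglongrightarrow> y"
        using LIMSEQ_Suc[OF grid_point_tendsto] .
      \<comment> \<open>Off the frontier, \<open>y\<close> has a neighbourhood inside
        \<open>P\<close> or inside its complement, and the rounded points eventually enter
        it.\<close>
      have "\<forall>\<^sub>F n in sequentially. indicator (A (Suc n)) y = (indicator P y :: real)"
      proof (cases "y \<in> P")
        case True
        then have "y \<in> interior P"
          using elim closure_subset by (auto simp: frontier_def)
        then have "\<forall>\<^sub>F n in sequentially. grid_point (Suc n) y /\<^sub>R real (Suc n) \<in> interior P"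
          using topological_tendstoD[OF lim open_interior] by blast
        then show ?thesis
          using True interior_subset[of P] by (auto elim!: eventually_mono simp: A_def indicator_def)
      next
        case False
        then have "\<forall>\<^sub>F n in sequentially. grid_point (Suc n) y /\<^sub>R real (Suc n) \<in> - P"
          using topological_tendstoD[OF lim, of "- P"] assms(1) by (simp add: compact_imp_closed open_Compl)
        then show ?thesis
          using False by (auto elim!: eventually_mono simp: A_def indicator_def)
      qed
      then show ?case by (rule tendsto_eventually)
    qed
  qed
  then have "(\<lambda>n. measure lebesgue (A (Suc n))) \<longlonglongrightarrow> measure lebesgue P"
    by simp
  then have "(\<lambda>n. lattice_count P (Suc n) / real (Suc n) ^ CARD('n)) \<longlonglongrightarrow> measure lebesgue P"
    using A by (simp add: measure_completion)
  then show ?thesis by (rule LIMSEQ_imp_Suc)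
qed

text \<open>If the degree were larger, dividing by \<open>n\<close> to that degree would give both
  the nonzero leading coefficient and 0 as limits.\<close>

lemma degree_le_of_tendsto:
  fixes p :: "real poly"
  assumes "(\<lambda>n. poly p (real n) / real n ^ d) \<longlonglongrightarrow> c"
  shows "degree p \<le> d"
proof (rule ccontr)
  assume "\<not> degree p \<le> d"
  then have deg: "degree p > d" by simp
  have "(\<lambda>n. poly p (real n) / real n ^ degree p) \<longlonglongrightarrow> lead_coeff p"
    using filterlim_compose[OF poly_divide_tendsto_aux]
      filterlim_mono[OF filterlim_real_sequentially at_top_le_at_infinity order_refl] by blast
  moreover have "(\<lambda>n. poly p (real n) / real n ^ degree p) \<longlonglongrightarrow> c * 0"
  proof (rule Lim_transform_eventually)
    have "(\<lambda>n. inverse (real n) ^ (degree p - d)) \<longlonglongrightarrow> 0 ^ (degree p - d)"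
      by (intro tendsto_power lim_inverse_n)
    then show "(\<lambda>n. poly p (real n) / real n ^ d * inverse (real n) ^ (degree p - d)) \<longlonglongrightarrow> c * 0"
      using assms deg by (intro tendsto_mult) (simp_all add: power_0_left)
    show "\<forall>\<^sub>F n in sequentially. poly p (real n) / real n ^ d * inverse (real n) ^ (degree p - d) =
        poly p (real n) / real n ^ degree p"
      using eventually_gt_at_top[of 0]
    proof eventually_elim
      case (elim n)
      have "real n ^ degree p = real n ^ d * real n ^ (degree p - d)"
        using deg by (simp flip: power_add)
      then show ?case by (simp add: field_simps)
    qed
  qed
  ultimately have "lead_coeff p = 0" using LIMSEQ_unique by fastforce
  then show False using deg by simp
qed

subsection \<open>The numerator of the generating function\<close>

text \<open>Shifting the argument keeps the degree and the leading coefficient, so the top terms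
  cancel. For constants the difference is 0.\<close>

lemma degree_backward_difference:
  fixes p :: "real poly"
  shows "p - pcompose p [:-1, 1:] = 0 \<or> degree (p - pcompose p [:-1, 1:]) < degree p"
proof (cases "degree p = 0")
  case True
  then obtain c where "p = [:c:]" by (rule degree_eq_zeroE)
  then show ?thesis by (simp add: pcompose_const)
next
  case False
  have "degree (pcompose p [:-1, 1:]) = degree p" by (simp add: degree_pcompose)
  moreover from this have "coeff (pcompose p [:-1, 1:]) (degree p) = lead_coeff p"
    using lead_coeff_comp[of "[:-1, 1::real:]" p] by simp
  ultimately show ?thesis
    using degree_less_if_less_eqI[of "p - pcompose p [:-1, 1:]" p]
      degree_diff_le[of p "degree p" "pcompose p [:-1, 1:]"] by auto
qed

lemma fps_one_minus_X_power_nth: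
  assumes "i > d"
  shows "fps_nth ((1 - fps_X) ^ d :: real fps) i = 0"
proof -
  have "(1 - fps_X) ^ d = fps_of_poly ([:1, -1::real:] ^ d)"
    by (simp add: fps_of_poly_power fps_of_poly_pCons)
  moreover have "degree ([:1, -1::real:] ^ d) \<le> d"
    using degree_power_le[of "[:1, -1::real:]" d] by simp
  ultimately show ?thesis using assms by (metis fps_of_poly_nth coeff_eq_0 le_less_trans)
qed

text \<open>Each factor \<open>1 - fps_X\<close> takes a backward difference of the coefficients and
  so lowers the degree of \<open>p\<close>.\<close>

lemma fps_poly_mult_power_nth:
  fixes p :: "real poly"
  assumes "degree p < d \<or> p = 0" "i \<ge> d"
  shows "fps_nth (Abs_fps (\<lambda>n. poly p (real n)) * (1 - fps_X) ^ d) i = 0"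
  using assms
proof (induction d arbitrary: p i)
  case 0
  then show ?case by (simp flip: fps_zero_def)
next
  case (Suc d)
  define q where "q = p - pcompose p [:-1, 1:]"
  have "degree q < d \<or> q = 0"
    using Suc.prems(1) degree_backward_difference[of p] by (auto simp: q_def)
  \<comment> \<open>The series has no term before index 0, so the coefficient there is
    \<open>p(0)\<close> instead of \<open>p(0) - p(-1)\<close>; the constant corrects this.\<close>
  have "Abs_fps (\<lambda>n. poly p (real n)) * (1 - fps_X) =
      Abs_fps (\<lambda>n. poly q (real n)) + fps_const (poly p (-1))"
    by (rule fps_ext) (auto simp: q_def poly_pcompose algebra_simps of_nat_diff)
  then have "Abs_fps (\<lambda>n. poly p (real n)) * (1 - fps_X) ^ Suc d =
      Abs_fps (\<lambda>n. poly q (real n)) * (1 - fps_X) ^ d + fps_const (poly p (-1)) * (1 - fps_X) ^ d"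
    by (simp add: distrib_right flip: mult.assoc)
  then show ?case
    using Suc.IH[OF \<open>degree q < d \<or> q = 0\<close>, of i] Suc.prems(2)
    by (simp add: fps_one_minus_X_power_nth)
qed

lemma fps_eq_mult_inverse_iff:
  fixes F G D :: "real fps"
  assumes "fps_nth D 0 \<noteq> 0"
  shows "F = G * inverse D \<longleftrightarrow> G = F * D"
proof
  show "G = F * D" if "F = G * inverse D"
    unfolding that mult.assoc inverse_mult_eq_1[OF assms] by simp
  show "F = G * inverse D" if "G = F * D"
    unfolding that mult.assoc inverse_mult_eq_1'[OF assms] by simp
qed

text \<open>The coefficients of the inverse of \<open>(1 - fps_X) ^ (d + 1)\<close> are the
  binomials \<open>(d + k) choose d\<close>, so the expansion is a Cauchy product.\<close>

lemma binomial_expansion_iff_fps: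
  fixes h f :: "nat \<Rightarrow> real"
  assumes "\<forall>i>d. h i = 0"
  shows "(\<forall>n. f n = (\<Sum>i\<le>d. h i * real ((n + d - i) choose d))) \<longleftrightarrow>
    Abs_fps h = Abs_fps f * (1 - fps_X) ^ (d + 1)"
proof -
  let ?D = "(1 - fps_X) ^ (d + 1) :: real fps"
  have unit: "fps_nth ?D 0 \<noteq> 0" by (simp add: fps_nth_power_0)
  have inv: "inverse ?D = Abs_fps (\<lambda>k. real ((d + k) choose k))"
    using one_minus_const_fps_X_neg_power'[of "d + 1" "1 :: real"] by simp
  have nth: "fps_nth (Abs_fps h * inverse ?D) n = (\<Sum>i\<le>d. h i * real ((n + d - i) choose d))" for n
  proof -
    have "fps_nth (Abs_fps h * inverse ?D) n = (\<Sum>i\<le>n. h i * real ((d + (n - i)) choose (n - i)))"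
      by (simp only: inv fps_mult_nth fps_nth_Abs_fps atLeast0AtMost)
    \<comment> \<open>For \<open>n < i \<le> d\<close> the upper index falls below \<open>d\<close>
      and the binomial is 0; for \<open>i > d\<close> the factor \<open>h i\<close> is 0.\<close>
    also have "\<dots> = (\<Sum>i\<le>d. h i * real ((n + d - i) choose d))"
    proof (rule sum.mono_neutral_cong)
      fix i assume i: "i \<in> {..n} \<inter> {..d}"
      have "n + d - i = d + (n - i)" using i by simp
      moreover have "(d + m) choose m = (d + m) choose d" for m
        using binomial_symmetric[of d "d + m"] by simp
      ultimately show "h i * real ((d + (n - i)) choose (n - i)) = h i * real ((n + d - i) choose d)"
        by presburger
    qed (use assms in \<open>auto simp: binomial_eq_0\<close>)
    finally show ?thesis .
  qed
  have "(\<forall>n. f n = (\<Sum>i\<le>d. h i * real ((n + d - i) choose d))) \<longleftrightarrow>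
      Abs_fps f = Abs_fps h * inverse ?D"
    by (simp only: fps_eq_iff nth fps_nth_Abs_fps)
  also have "\<dots> \<longleftrightarrow> Abs_fps h = Abs_fps f * ?D"
    by (rule fps_eq_mult_inverse_iff[OF unit])
  finally show ?thesis .
qed

text \<open>The degree bound makes the product vanish beyond \<open>CARD('n)\<close>, so it meets
  the definite description; inverting the power series gives uniqueness.\<close>

lemma mixed_hstar_eq:
  fixes P :: "nat \<Rightarrow> (real ^ 'n::finite) set"
  assumes "degree (mixed_ehrhart_poly k P) \<le> CARD('n)"
  shows "mixed_hstar k P = fps_nth (Abs_fps (\<lambda>n. poly (mixed_ehrhart_poly k P) (real n)) *
    (1 - fps_X) ^ (CARD('n) + 1))" (is "_ = fps_nth ?H")
  unfolding mixed_hstar_def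
proof (rule the_equality)
  have zero: "\<forall>i>CARD('n). fps_nth ?H i = 0"
    using fps_poly_mult_power_nth[of "mixed_ehrhart_poly k P" "CARD('n) + 1"] assms by simp
  then show "(\<forall>i>CARD('n). fps_nth ?H i = 0) \<and>
      (\<forall>n. poly (mixed_ehrhart_poly k P) (real n) =
        (\<Sum>i\<le>CARD('n). fps_nth ?H i * real (n + CARD('n) - i choose CARD('n))))"
    by (subst binomial_expansion_iff_fps) (auto simp: fps_nth_inverse)
  show "h = fps_nth ?H"
    if "(\<forall>i>CARD('n). h i = 0) \<and> (\<forall>n. poly (mixed_ehrhart_poly k P) (real n) =
        (\<Sum>i\<le>CARD('n). h i * real (n + CARD('n) - i choose CARD('n))))" for h
  proof -
    have "Abs_fps h = ?H"
      using that binomial_expansion_iff_fps[of "CARD('n)" h "\<lambda>n. poly (mixed_ehrhart_poly k P) (real n)"]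
      by blast
    then show ?thesis by (metis fps_nth_Abs_fps ext)
  qed
qed

text \<open>This is the form of \<open>mixed_hstar_eq\<close> with \<open>n ^ d\<close> as the
  sequence, which makes the two sides of the limit comparable.\<close>

lemma coeff_eulerian_poly:
  "coeff (eulerian_poly d) i = fps_nth (Abs_fps (\<lambda>n. real n ^ d) * (1 - fps_X) ^ (d + 1)) i"
proof -
  let ?D = "(1 - fps_X) ^ (d + 1) :: real fps"
  let ?F = "Abs_fps (\<lambda>n. real n ^ d)"
  have unit: "fps_nth ?D 0 \<noteq> 0" by (simp add: fps_nth_power_0)
  have iff: "?F = fps_of_poly A / ?D \<longleftrightarrow> fps_of_poly A = ?F * ?D" for A
    unfolding fps_divide_unit[OF unit] by (rule fps_eq_mult_inverse_iff[OF unit])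
  \<comment> \<open>The product has no coefficients beyond \<open>d\<close>, so the first
    \<open>d + 1\<close> of them determine it.\<close>
  define A where "A = Poly (map (fps_nth (?F * ?D)) [0..<d + 1])"
  have "fps_nth (?F * ?D) i = 0" if "i \<ge> d + 1" for i
    using fps_poly_mult_power_nth[of "monom 1 d" "d + 1" i] that
    by (simp add: poly_monom degree_monom_eq)
  then have A: "fps_of_poly A = ?F * ?D"
    by (intro fps_ext) (auto simp: A_def nth_default_def not_less simp del: upt_Suc)
  have "eulerian_poly d = A"
    unfolding eulerian_poly_def iff
    by (rule the_equality) (use A in \<open>auto simp flip: fps_of_poly_eq_iff\<close>)
  then show ?thesis by (metis A fps_of_poly_nth)
qed

subsection \<open>Dilated Minkowski sums\<close>

lemma lattice_polytope_compact_convex: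
  assumes "lattice_polytope P"
  shows "compact P" "convex P"
  using assms by (auto simp: lattice_polytope_def finite_imp_compact_convex_hull convex_convex_hull)

lemma integer_points_mult_nat: "x \<in> integer_points \<Longrightarrow> real r *\<^sub>R x \<in> integer_points"
  by (auto simp: integer_points_def)

lemma lattice_polytope_dilate:
  assumes "lattice_polytope P"
  shows "lattice_polytope (dilate r P)"
proof -
  obtain V where "finite V" "V \<noteq> {}" "V \<subseteq> integer_points" "P = convex hull V"
    using assms by (auto simp: lattice_polytope_def)
  then show ?thesis
    unfolding lattice_polytope_def dilate_def
    by (intro exI[of _ "(*\<^sub>R) (real r) ` V"])
       (auto simp: convex_hull_scaling intro: integer_points_mult_nat)
qed

lemma lattice_polytope_mink_sum:
  fixes P :: "nat \<Rightarrow> (real ^ 'n::finite) set"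
  assumes "finite J" "\<And>j. j \<in> J \<Longrightarrow> lattice_polytope (P j)"
  shows "lattice_polytope (mink_sum P J)"
  using assms
proof (induction J rule: finite_induct)
  case empty
  then show ?case
    by (auto simp: mink_sum_def lattice_polytope_def integer_points_def set_zero intro!: exI[of _ "{0}"])
next
  case (insert j J)
  obtain V where V: "finite V" "V \<noteq> {}" "V \<subseteq> integer_points" "P j = convex hull V"
    using insert.prems[of j] unfolding lattice_polytope_def by blast
  obtain W where W: "finite W" "W \<noteq> {}" "W \<subseteq> integer_points" "mink_sum P J = convex hull W"
    using insert.IH insert.prems by (auto simp: lattice_polytope_def)
  have "mink_sum P (insert j J) = convex hull (V + W)"
    using insert.hyps V W by (simp add: mink_sum_def convex_hull_set_plus)
  moreover have "finite (V + W)"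
    using V(1) W(1) by (rule finite_set_plus)
  moreover have "V + W \<noteq> {}"
    using V(2) W(2) set_plus_intro by blast
  moreover have "V + W \<subseteq> integer_points"
    using V(3) W(3) by (auto intro: integer_points_add elim!: set_plus_elim)
  ultimately show ?case
    unfolding lattice_polytope_def by blast
qed

lemma mink_sum_dilate:
  fixes P :: "nat \<Rightarrow> (real ^ 'n::finite) set"
  shows "mink_sum (\<lambda>j. dilate r (P j)) J = dilate r (mink_sum P J)"
proof (induction J rule: infinite_finite_induct)
  case (insert j J)
  have "dilate r (A + B) = dilate r A + dilate r B" for A B :: "(real ^ 'n) set"
    by (force simp: dilate_def set_plus_def scaleR_add_right image_iff)
  then show ?case using insert by (simp add: mink_sum_def)
\<comment> \<open>For infinite \<open>J\<close> both sums default to the singleton of the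
  origin.\<close>
qed (simp_all add: mink_sum_def dilate_def set_zero)

lemma lattice_count_dilate: "lattice_count (dilate r P) n = lattice_count P (n * r)"
  by (simp add: lattice_count_def dilate_def image_image)

lemma lattice_count_dilate_asymptotics:
  fixes P :: "(real ^ 'n::finite) set"
  assumes "lattice_polytope P"
  shows "(\<lambda>r. lattice_count P (n * r) / real r ^ CARD('n)) \<longlonglongrightarrow> measure lebesgue P * real n ^ CARD('n)"
proof (cases "n = 0")
  case True
  \<comment> \<open>The count does not depend on \<open>r\<close> here, and the limit is 0 because
    the dimension is positive.\<close>
  have "(\<lambda>r. lattice_count P 0 * inverse (real r) ^ CARD('n)) \<longlonglongrightarrow> lattice_count P 0 * 0 ^ CARD('n)"
    by (intro tendsto_intros lim_inverse_n)
  then show ?thesis using True by (simp add: divide_inverse power_inverse power_0_left)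
next
  case False
  have "(\<lambda>r. lattice_count P (n * r) / real (n * r) ^ CARD('n)) \<longlonglongrightarrow> measure lebesgue P"
  proof (rule filterlim_compose[OF lattice_count_asymptotics])
    show "filterlim (\<lambda>r. n * r) sequentially sequentially"
      using False by (intro filterlim_subseq) (simp add: strict_mono_def)
  qed (use lattice_polytope_compact_convex[OF assms] in auto)
  then have "(\<lambda>r. lattice_count P (n * r) / real (n * r) ^ CARD('n) * real n ^ CARD('n))
      \<longlonglongrightarrow> measure lebesgue P * real n ^ CARD('n)"
    by (intro tendsto_mult tendsto_const)
  then show ?thesis
    using False by (simp add: power_mult_distrib)
qed

lemma degree_ehrhart_poly:
  fixes P :: "(real ^ 'n::finite) set"
  assumes "lattice_polytope P"
  shows "degree (ehrhart_poly P) \<le> CARD('n)"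
  using lattice_count_asymptotics[OF lattice_polytope_compact_convex[OF assms]]
  by (intro degree_le_of_tendsto) (simp add: ehrhart_poly_eq[OF assms])

section \<open>The coefficientwise limit\<close>

theorem theorem4p5:
  fixes P :: "nat \<Rightarrow> (real ^ 'n::finite) set" and k :: nat
  assumes "k \<ge> 1"
    and "\<And>j. j \<in> {1..k} \<Longrightarrow> lattice_polytope (P j)"
    and "\<And>j. j \<in> {1..k} \<Longrightarrow> aff_dim (P j) = int CARD('n)"
  shows "\<forall>i. (\<lambda>r. coeff (smult (1 / real r ^ CARD('n))
                        (mixed_hstar_poly k (\<lambda>j. dilate r (P j)))) i)
             \<longlonglongrightarrow> coeff (\<Sum>J\<in>Pow {1..k}.
                   smult ((-1) ^ (k - card J) * measure lebesgue (mink_sum P J))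
                     (eulerian_poly CARD('n))) i"
proof
  fix i
  let ?d = "CARD('n)"
  let ?D = "(1 - fps_X) ^ (?d + 1) :: real fps"
  let ?s = "\<lambda>J :: nat set. (-1) ^ (k - card J) :: real"
  define vol where "vol = (\<Sum>J\<in>Pow {1..k}. ?s J * measure lebesgue (mink_sum P J))"
  define f where "f r n = poly (mixed_ehrhart_poly k (\<lambda>j. dilate r (P j))) (real n)" for r n
  have poly_J: "lattice_polytope (mink_sum P J)" if "J \<in> Pow {1..k}" for J
    using that assms(2) by (intro lattice_polytope_mink_sum) (auto intro: finite_subset)
  have f: "f r n = (\<Sum>J\<in>Pow {1..k}. ?s J * lattice_count (mink_sum P J) (n * r))" for r n
    unfolding f_def mixed_ehrhart_poly_def mink_sum_dilate poly_sum poly_smult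
    by (intro sum.cong refl)
       (simp add: ehrhart_poly_eq[OF lattice_polytope_dilate[OF poly_J]] lattice_count_dilate)
  have deg: "degree (mixed_ehrhart_poly k (\<lambda>j. dilate r (P j))) \<le> ?d" for r
    unfolding mixed_ehrhart_poly_def mink_sum_dilate
    by (intro degree_sum_le order_trans[OF degree_smult_le] degree_ehrhart_poly
         lattice_polytope_dilate poly_J) auto
  have hstar: "mixed_hstar k (\<lambda>j. dilate r (P j)) = fps_nth (Abs_fps (f r) * ?D)" for r
    unfolding f_def using deg by (rule mixed_hstar_eq)
  have f_lim: "(\<lambda>r. f r n / real r ^ ?d) \<longlonglongrightarrow> vol * real n ^ ?d" for n
    unfolding f vol_def sum_divide_distrib sum_distrib_right
  proof (rule tendsto_sum)
    fix J assume "J \<in> Pow {1..k}"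
    from tendsto_mult_left[OF lattice_count_dilate_asymptotics[OF poly_J[OF this], of n], of "?s J"]
    show "(\<lambda>r. ?s J * lattice_count (mink_sum P J) (n * r) / real r ^ ?d)
        \<longlonglongrightarrow> ?s J * measure lebesgue (mink_sum P J) * real n ^ ?d"
      by (simp add: mult.assoc)
  qed
  \<comment> \<open>The \<open>i\<close>-th coefficient of the product only involves the finitely
    many \<open>n \<le> i\<close>, so pointwise limits in \<open>n\<close> suffice.\<close>
  have lim: "(\<lambda>r. fps_nth (Abs_fps (f r) * ?D) i / real r ^ ?d)
      \<longlonglongrightarrow> vol * fps_nth (Abs_fps (\<lambda>n. real n ^ ?d) * ?D) i"
    unfolding fps_mult_nth fps_nth_Abs_fps sum_divide_distrib sum_distrib_left
  proof (rule tendsto_sum)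
    fix n
    from tendsto_mult_right[OF f_lim[of n], of "fps_nth ?D (i - n)"]
    show "(\<lambda>r. f r n * fps_nth ?D (i - n) / real r ^ ?d)
        \<longlonglongrightarrow> vol * (real n ^ ?d * fps_nth ?D (i - n))"
      by (simp add: mult.assoc)
  qed
  have "coeff (smult (1 / real r ^ ?d) (mixed_hstar_poly k (\<lambda>j. dilate r (P j)))) i =
      fps_nth (Abs_fps (f r) * ?D) i / real r ^ ?d" for r
  proof -
    \<comment> \<open>Beyond the dimension the polynomial has no terms by construction, and the
      product vanishes by the degree bound.\<close>
    have "fps_nth (Abs_fps (f r) * ?D) i = 0" if "i > ?d"
      unfolding f_def using that deg[of r] by (intro fps_poly_mult_power_nth) auto
    then show ?thesis
      by (auto simp: mixed_hstar_poly_def coeff_sum hstar)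
  qed
  moreover have "coeff (\<Sum>J\<in>Pow {1..k}. smult (?s J * measure lebesgue (mink_sum P J))
      (eulerian_poly ?d)) i = vol * fps_nth (Abs_fps (\<lambda>n. real n ^ ?d) * ?D) i"
    by (simp add: coeff_sum vol_def sum_distrib_right coeff_eulerian_poly)
  ultimately show "(\<lambda>r. coeff (smult (1 / real r ^ ?d) (mixed_hstar_poly k (\<lambda>j. dilate r (P j)))) i)
      \<longlonglongrightarrow> coeff (\<Sum>J\<in>Pow {1..k}. smult (?s J * measure lebesgue (mink_sum P J)) (eulerian_poly ?d)) i"
    using lim by (simp only:)
qed

end
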